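(* Let $X$ be a nonempty finite set, $\Theta$ a nonempty set, and $(\mathsf P_\theta)_{\theta\in\Theta}$ a family of probability measures on the sigma-algebra of all subsets of $X$. For $x\in X$ let $\ell_x\colon\Theta\to\mathbb R$, $\ell_x(\theta):=\mathsf P_\theta(\{x\})$. Let $T\colon X\to\mathbb R$ be a statistic, and for each $t\in T(X):=\{T(x)\colon x\in X\}$ let $B_t$ be any linear basis of the set $\{\ell_x\colon x\in X,\ T(x)=t\}$ of likelihood functions. Then $T$ is a UMVUE if and only if the union $\bigcup_{t\in T(X)}B_t$ of the bases is linearly independent.
   Context: The set $X$ of samples is nonempty and finite, equipped with the sigma-algebra of all its subsets; the parameter space $\Theta$ is an arbitrary nonempty set (possibly infinite). A statistic (or estimator) is any function $T\colon X\to\mathbb R$. $\mathsf E_\theta$ and $\mathsf{Var}_\theta$ denote expectation and variance with respect to $\mathsf P_\theta$. The function $\ell_x$ is called the likelihood function corresponding to the sample $x$. For a function $b\colon\Theta\to\mathbb R$, a statistic $T$ is an unbiased estimator of $b$ if $\mathsf E_\theta T=b(\theta)$ for all $\theta\in\Theta$; $\mathcal E_b$ is the set of all unbiased estimators of $b$. A statistic $T$ is a uniformly minimum variance unbiased estimator (UMVUE) of $b$ if $T\in\mathcal E_b$ and, for every $\tilde T\in\mathcal E_b$ and every $\theta\in\Theta$, $\mathsf{Var}_\theta T\le\mathsf{Var}_\theta\tilde T$. "$T$ is a UMVUE" means that $T$ is a UMVUE of some function $b\colon\Theta\to\mathbb R$. A linear basis of a set $A$ of functions from $\Theta$ to $\mathbb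 R$ is a linearly independent subset of $A$ having the same linear span as $A$; in particular, $B_t$ is empty if $\ell_x=0$ for all $x\in X$ with $T(x)=t$. The sum of an empty family is taken to be zero. Linear independence is in the real vector space $\mathbb R^\Theta$ of all functions from $\Theta$ to $\mathbb R$.
   Formalization: The union of the bases is read as an indexed family: a function lying in two different B_t counts twice and makes it dependent, so independence means the B_t are pairwise disjoint and their union is linearly independent. With a plain set union the claim fails (fair coin, one θ, T injective). *)

theory Defs
  imports "HOL-Probability.Probability" "HOL-Library.Function_Algebras"
begin

text \<open>The real vector space of all functions from a type to a real vector space.\<close>

instantiation "fun" :: (type, real_vector) real_vector
begin

definition "scaleR r f = (\<lambda>x. r *\<^sub>R f x)"

instance
  by standard
    (simp_all add: scaleR_fun_def fun_eq_iff scaleR_add_right scaleR_add_left)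

end

definition linear_basis :: "'b::real_vector set \<Rightarrow> 'b set \<Rightarrow> bool" where
  "linear_basis A B \<longleftrightarrow> B \<subseteq> A \<and> independent B \<and> span B = span A"

text \<open>
  Linear independence of an indexed family. Unlike for \<^const>\<open>independent\<close>, a vector that
  occurs at two different indices makes the family dependent. The union of the bases \<open>B t\<close> is
  taken as a family in this sense, indexed by \<open>SIGMA t:I. B t\<close>: two points with proportional
  nonzero likelihood functions but different values of the statistic must be detected as
  dependent even if they contribute the same function to two bases, which a union of sets
  would identify.
\<close>

definition independent_family :: "('i \<Rightarrow> 'b::real_vector) \<Rightarrow> 'i set \<Rightarrow> bool" where
  "independent_family v I \<longleftrightarrow>
     (\<forall>S c. finite S \<and> S \<subseteq> I \<and> (\<Sum>i\<in>S. c i *\<^sub>R v i) = 0 \<longrightarrow> (\<forall>i\<in>S. c i = 0))"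

lemma independent_family_iff:
  "independent_family v I \<longleftrightarrow> inj_on v I \<and> independent (v ` I)"
proof
  assume ind: "independent_family v I"
  have inj: "inj_on v I"
  proof (rule inj_onI, rule ccontr)
    fix i j assume ij: "i \<in> I" "j \<in> I" "v i = v j" "i \<noteq> j"
    define c where "c k = (if k = i then 1 else -1 :: real)" for k
    have "(\<Sum>k\<in>{i, j}. c k *\<^sub>R v k) = 0"
      using ij by (simp add: c_def)
    then have "c i = 0"
      using ind[unfolded independent_family_def, rule_format, of "{i, j}" c i] ij by simp
    then show False by (simp add: c_def)
  qed
  moreover have "independent (v ` I)"
    unfolding independent_explicit_module
  proof (intro allI impI)
    fix t u w
    assume t: "finite t" "t \<subseteq> v ` I" "(\<Sum>v\<in>t. u v *\<^sub>R v) = 0" "w \<in> t"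
    then obtain S where S: "S \<subseteq> I" "finite S" "t = v ` S"
      by (meson finite_subset_image)
    have "(\<Sum>i\<in>S. u (v i) *\<^sub>R v i) = 0"
      using t(3) S inj_on_subset[OF inj S(1)] by (simp add: sum.reindex)
    then have "\<forall>i\<in>S. u (v i) = 0"
      using ind[unfolded independent_family_def, rule_format, of S "\<lambda>i. u (v i)"] S by blast
    then show "u w = 0"
      using t(4) S by auto
  qed
  ultimately show "inj_on v I \<and> independent (v ` I)" ..
next
  assume *: "inj_on v I \<and> independent (v ` I)"
  show "independent_family v I"
    unfolding independent_family_def
  proof (intro allI impI ballI)
    fix S c i
    assume S: "finite S \<and> S \<subseteq> I \<and> (\<Sum>i\<in>S. c i *\<^sub>R v i) = 0" and i: "i \<in> S"
    have inj: "inj_on v S"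
      using * S inj_on_subset by blast
    have "(\<Sum>w\<in>v ` S. c (the_inv_into S v w) *\<^sub>R w) = 0"
      using S by (simp add: sum.reindex inj the_inv_into_f_f[OF inj])
    then have "c (the_inv_into S v (v i)) = 0"
      using *[THEN conjunct2, unfolded independent_explicit_module, rule_format,
          of "v ` S" "\<lambda>w. c (the_inv_into S v w)" "v i"] S i by blast
    then show "c i = 0"
      by (simp add: the_inv_into_f_f[OF inj i])
  qed
qed

lemma independent_family_Sigma_iff:
  "independent_family snd (SIGMA t:I. B t) \<longleftrightarrow>
     disjoint_family_on B I \<and> independent (\<Union>t\<in>I. B t)"
proof -
  have "inj_on snd (SIGMA t:I. B t) \<longleftrightarrow> disjoint_family_on B I"
    by (auto simp: inj_on_def disjoint_family_on_def)
  moreover have "snd ` (SIGMA t:I. B t) = (\<Union>t\<in>I. B t)"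
    by force
  ultimately show ?thesis
    by (simp add: independent_family_iff)
qed

definition likelihood :: "('p \<Rightarrow> 'a measure) \<Rightarrow> 'a \<Rightarrow> 'p \<Rightarrow> real" where
  "likelihood P x = (\<lambda>\<theta>. measure (P \<theta>) {x})"

definition unbiased_estimators :: "('p \<Rightarrow> 'a measure) \<Rightarrow> ('p \<Rightarrow> real) \<Rightarrow> ('a \<Rightarrow> real) set" where
  "unbiased_estimators P b = {T. \<forall>\<theta>. prob_space.expectation (P \<theta>) T = b \<theta>}"

definition umvue_of :: "('p \<Rightarrow> 'a measure) \<Rightarrow> ('p \<Rightarrow> real) \<Rightarrow> ('a \<Rightarrow> real) \<Rightarrow> bool" where
  "umvue_of P b T \<longleftrightarrow>
     T \<in> unbiased_estimators P b \<and>
     (\<forall>T' \<in> unbiased_estimators P b. \<forall>\<theta>.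
        prob_space.variance (P \<theta>) T \<le> prob_space.variance (P \<theta>) T')"

definition umvue :: "('p \<Rightarrow> 'a measure) \<Rightarrow> ('a \<Rightarrow> real) \<Rightarrow> bool" where
  "umvue P T \<longleftrightarrow> (\<exists>b. umvue_of P b T)"

end

(* By the covariance criterion, T is a UMVUE iff the space of unbiased estimators U of zero, that is
   of the linear relations sum_x U(x) l_x = 0, is closed under multiplication by T. It is then closed
   under multiplication by polynomials in T, hence by the indicators of the fibers {T = t}, so every
   linear relation among the likelihood functions splits into relations within the single fibers.
   This says that the spans of the fibers form a direct sum, that is, that bases of these spans
   together form an independent family. *)

theory Submission
  imports Defs
begin

section \<open>Spans of finite families and direct sums of spans\<close>

lemma sum_fun_apply: "(\<Sum>i\<in>I. f i) \<theta> = (\<Sum>i\<in>I. f i \<theta>)"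
  for f :: "'i \<Rightarrow> 'p \<Rightarrow> 'b::comm_monoid_add"
  by (induction I rule: infinite_finite_induct) auto

text \<open>Coefficients belong to indices rather than to vectors, so that distinct samples sharing
  one likelihood function keep separate coefficients.\<close>

lemma span_family_explicit:
  fixes v :: "'i \<Rightarrow> 'b::real_vector"
  assumes "finite I"
  shows "w \<in> span (v ` I) \<longleftrightarrow> (\<exists>c. w = (\<Sum>i\<in>I. c i *\<^sub>R v i))"
proof
  assume "w \<in> span (v ` I)"
  then show "\<exists>c. w = (\<Sum>i\<in>I. c i *\<^sub>R v i)"
  proof (induction rule: span_induct_alt)
    case base
    show ?case by (rule exI[of _ "\<lambda>_. 0"]) simp
  next
    case (step a x y)
    then obtain j c where j: "j \<in> I" "x = v j" and c: "y = (\<Sum>i\<in>I. c i *\<^sub>R v i)" by blast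
    \<comment> \<open>Only the coefficient at the chosen index \<open>j\<close> is raised, even if
      \<open>v\<close> takes the value \<open>x\<close> at other indices too.\<close>
    have "(\<Sum>i\<in>I. (c i + (if i = j then a else 0)) *\<^sub>R v i)
        = y + (\<Sum>i\<in>I. if i = j then a *\<^sub>R v j else 0)"
      unfolding c sum.distrib[symmetric] by (intro sum.cong) (auto simp: algebra_simps)
    also have "\<dots> = a *\<^sub>R x + y"
      using j assms by simp
    finally show ?case by metis
  qed
next
  assume "\<exists>c. w = (\<Sum>i\<in>I. c i *\<^sub>R v i)"
  then show "w \<in> span (v ` I)"
    by (auto intro!: span_sum span_scale intro: span_base)
qed

text \<open>The right-hand side says that the sum of the spans is direct and mentions no bases, so
  the choice of \<open>B\<close> is immaterial. A relation among basis elements, grouped by the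
  index \<open>t\<close>, is a zero sum with one vector from each span; independence of the single
  \<open>B t\<close> translates vanishing vectors into vanishing coefficients.\<close>

lemma independent_family_linear_bases_iff:
  fixes A B :: "'i \<Rightarrow> 'b::real_vector set"
  assumes fin: "finite I" and basis: "\<And>t. t \<in> I \<Longrightarrow> linear_basis (A t) (B t)"
  shows "independent_family snd (SIGMA t:I. B t) \<longleftrightarrow>
    (\<forall>v. (\<forall>t\<in>I. v t \<in> span (A t)) \<and> (\<Sum>t\<in>I. v t) = 0 \<longrightarrow> (\<forall>t\<in>I. v t = 0))"
    (is "?indep \<longleftrightarrow> ?direct")
proof
  assume ind: ?indep
  show ?direct
  proof (intro allI impI)
    fix v assume v: "(\<forall>t\<in>I. v t \<in> span (A t)) \<and> (\<Sum>t\<in>I. v t) = 0"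
    have "\<forall>t\<in>I. \<exists>S r. finite S \<and> S \<subseteq> B t \<and> v t = (\<Sum>b\<in>S. r b *\<^sub>R b)"
    proof
      fix t assume t: "t \<in> I"
      then have "v t \<in> span (B t)"
        using v basis[OF t] by (simp add: linear_basis_def)
      then show "\<exists>S r. finite S \<and> S \<subseteq> B t \<and> v t = (\<Sum>b\<in>S. r b *\<^sub>R b)"
        by (auto simp: span_explicit)
    qed
    then obtain S r where S: "\<And>t. t \<in> I \<Longrightarrow> finite (S t)" "\<And>t. t \<in> I \<Longrightarrow> S t \<subseteq> B t"
      and r: "\<And>t. t \<in> I \<Longrightarrow> v t = (\<Sum>b\<in>S t. r t b *\<^sub>R b)"
      by metis
    have "(\<Sum>p\<in>(SIGMA t:I. S t). r (fst p) (snd p) *\<^sub>R snd p) = (\<Sum>t\<in>I. \<Sum>b\<in>S t. r t b *\<^sub>R b)"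
      using fin S by (subst sum.Sigma) (auto simp: case_prod_beta)
    also have "\<dots> = 0"
      using v r by simp
    finally have "(\<Sum>p\<in>(SIGMA t:I. S t). r (fst p) (snd p) *\<^sub>R snd p) = 0" .
    moreover have "finite (SIGMA t:I. S t)" "(SIGMA t:I. S t) \<subseteq> (SIGMA t:I. B t)"
      using fin S by (auto intro!: finite_SigmaI)
    ultimately have "\<forall>p\<in>(SIGMA t:I. S t). r (fst p) (snd p) = 0"
      using ind[unfolded independent_family_def, rule_format,
          of "SIGMA t:I. S t" "\<lambda>p. r (fst p) (snd p)"] by blast
    then show "\<forall>t\<in>I. v t = 0"
      by (auto simp: r)
  qed
next
  assume dir: ?direct
  show ?indep
    unfolding independent_family_def
  proof (intro allI impI ballI)
    fix S c p
    assume S: "finite S \<and> S \<subseteq> (SIGMA t:I. B t) \<and> (\<Sum>p\<in>S. c p *\<^sub>R snd p) = 0" and p: "p \<in> S"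
    \<comment> \<open>The part of the given relation whose pairs have first component
      \<open>t\<close>.\<close>
    define v where "v t = (\<Sum>b\<in>S `` {t}. c (t, b) *\<^sub>R b)" for t
    have fin_fiber: "finite (S `` {t})" for t
      using S by (simp add: finite_Image)
    have S_eq: "S = (SIGMA t:I. S `` {t})"
      using S by auto
    have "(\<Sum>t\<in>I. v t) = (\<Sum>p\<in>(SIGMA t:I. S `` {t}). c p *\<^sub>R snd p)"
      unfolding v_def using fin fin_fiber by (subst sum.Sigma) (auto simp: case_prod_beta)
    also have "\<dots> = 0"
      using S S_eq by simp
    finally have "(\<Sum>t\<in>I. v t) = 0" .
    moreover have "v t \<in> span (A t)" if "t \<in> I" for t
      unfolding v_def using basis[OF that] S
      by (auto simp: linear_basis_def intro!: span_sum span_scale intro: span_base)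
    moreover obtain t b where tb: "p = (t, b)" "t \<in> I"
      using p S by auto
    ultimately have "v t = 0"
      using dir by blast
    moreover have indep: "independent (B t)" and "S `` {t} \<subseteq> B t"
      using basis[OF tb(2)] S by (auto simp: linear_basis_def)
    ultimately have "c (t, b) = 0"
      using fin_fiber[of t] p tb
      by (intro indep[unfolded independent_explicit_module, rule_format,
            of "S `` {t}" "\<lambda>b. c (t, b)"]) (simp_all add: v_def)
    then show "c p = 0"
      using tb by simp
  qed
qed

section \<open>Linear relations and the fibers of the statistic\<close>

lemma relation_splits_into_fibers:
  fixes T :: "'a \<Rightarrow> real" and l :: "'a \<Rightarrow> 'b::real_vector"
  assumes fin: "finite X"
    and closed: "\<And>U. (\<Sum>x\<in>X. U x *\<^sub>R l x) = 0 \<Longrightarrow> (\<Sum>x\<in>X. (T x * U x) *\<^sub>R l x) = 0"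
    and U: "(\<Sum>x\<in>X. U x *\<^sub>R l x) = 0"
  shows "(\<Sum>x | x \<in> X \<and> T x = t. U x *\<^sub>R l x) = 0"
proof -
  \<comment> \<open>A polynomial in \<open>T x\<close> with root set \<open>F\<close>. Multiplying a
    relation by it amounts to multiplying by one factor \<open>T x - s\<close> after another:
    \<open>closed\<close> handles \<open>T x\<close>, linearity the constant
    \<open>s\<close>.\<close>
  define q where "q F x = (\<Prod>s\<in>F. T x - s)" for F x
  have q: "(\<Sum>x\<in>X. (q F x * U x) *\<^sub>R l x) = 0" if "finite F" for F
    using that
  proof induction
    case empty
    then show ?case using U by (simp add: q_def)
  next
    case (insert s F)
    have "(\<Sum>x\<in>X. (q (insert s F) x * U x) *\<^sub>R l x)
        = (\<Sum>x\<in>X. (T x * (q F x * U x)) *\<^sub>R l x) - s *\<^sub>R (\<Sum>x\<in>X. (q F x * U x) *\<^sub>R l x)"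
      using insert.hyps
      by (simp add: q_def algebra_simps scaleR_sum_right sum_subtractf)
    then show ?case
      using insert.IH closed by simp
  qed
  \<comment> \<open>With all other values of \<open>T\<close> as roots, \<open>q ?F\<close> vanishes
    off the fiber and equals the nonzero constant \<Prod>(t - s) on it: a multiple of the indicator
    of the fiber.\<close>
  let ?F = "T ` X - {t}"
  have "(\<Sum>x | x \<in> X \<and> T x = t. (q ?F x * U x) *\<^sub>R l x) = (\<Sum>x\<in>X. (q ?F x * U x) *\<^sub>R l x)"
    using fin by (intro sum.mono_neutral_left) (auto simp: q_def)
  also have "\<dots> = 0"
    using fin by (intro q) auto
  also have "(\<Sum>x | x \<in> X \<and> T x = t. (q ?F x * U x) *\<^sub>R l x)
      = (\<Prod>s\<in>?F. t - s) *\<^sub>R (\<Sum>x | x \<in> X \<and> T x = t. U x *\<^sub>R l x)"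
    by (auto simp: q_def scaleR_sum_right intro!: sum.cong)
  finally show ?thesis
    using fin by auto
qed

text \<open>Vectors from the fiber spans with zero sum amount to one relation on \<open>X\<close>,
  which closedness splits into the single fibers. Conversely, directness kills the part of a
  relation on each fiber, and multiplication by \<open>T\<close> merely rescales that part.\<close>

lemma relations_closed_iff_fiber_spans_direct:
  fixes T :: "'a \<Rightarrow> real" and l :: "'a \<Rightarrow> 'b::real_vector"
  assumes fin: "finite X"
  shows "(\<forall>U. (\<Sum>x\<in>X. U x *\<^sub>R l x) = 0 \<longrightarrow> (\<Sum>x\<in>X. (T x * U x) *\<^sub>R l x) = 0) \<longleftrightarrow>
    (\<forall>v. (\<forall>t\<in>T ` X. v t \<in> span {l x | x. x \<in> X \<and> T x = t}) \<and> (\<Sum>t\<in>T ` X. v t) = 0 \<longrightarrow>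
      (\<forall>t\<in>T ` X. v t = 0))" (is "?closed \<longleftrightarrow> ?direct")
proof
  assume closed: ?closed
  show ?direct
  proof (intro allI impI)
    fix v assume v: "(\<forall>t\<in>T ` X. v t \<in> span {l x | x. x \<in> X \<and> T x = t}) \<and> (\<Sum>t\<in>T ` X. v t) = 0"
    have "\<forall>t\<in>T ` X. \<exists>c. v t = (\<Sum>x | x \<in> X \<and> T x = t. c x *\<^sub>R l x)"
      using v fin by (simp add: setcompr_eq_image span_family_explicit)
    then obtain c where c: "\<And>t. t \<in> T ` X \<Longrightarrow> v t = (\<Sum>x | x \<in> X \<and> T x = t. c t x *\<^sub>R l x)"
      by metis
    \<comment> \<open>The fibers partition \<open>X\<close>, so the coefficients of all fibers merge
      into the single function sending \<open>x\<close> to \<open>c (T x) x\<close>.\<close>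
    have v_eq: "v t = (\<Sum>x | x \<in> X \<and> T x = t. c (T x) x *\<^sub>R l x)" if "t \<in> T ` X" for t
      unfolding c[OF that] by (intro sum.cong) auto
    have "(\<Sum>x\<in>X. c (T x) x *\<^sub>R l x) = (\<Sum>t\<in>T ` X. v t)"
      using fin by (simp add: sum.image_gen[of X _ T] v_eq)
    also have "\<dots> = 0"
      using v by simp
    finally have "(\<Sum>x\<in>X. c (T x) x *\<^sub>R l x) = 0" .
    then have "(\<Sum>x | x \<in> X \<and> T x = t. c (T x) x *\<^sub>R l x) = 0" for t
      using closed
      by (intro relation_splits_into_fibers[where U = "\<lambda>x. c (T x) x", OF fin]) simp_all
    then show "\<forall>t\<in>T ` X. v t = 0"
      using v_eq by simp
  qed
next
  assume dir: ?direct
  show ?closed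
  proof (intro allI impI)
    fix U assume U: "(\<Sum>x\<in>X. U x *\<^sub>R l x) = 0"
    define v where "v t = (\<Sum>x | x \<in> X \<and> T x = t. U x *\<^sub>R l x)" for t
    have "(\<Sum>t\<in>T ` X. v t) = 0"
      using U fin by (simp add: v_def sum.image_gen[of X _ T])
    moreover have "v t \<in> span {l x | x. x \<in> X \<and> T x = t}" for t
      unfolding v_def by (auto intro!: span_sum span_scale intro: span_base)
    ultimately have v: "\<forall>t\<in>T ` X. v t = 0"
      using dir by blast
    have "(\<Sum>x\<in>X. (T x * U x) *\<^sub>R l x)
        = (\<Sum>t\<in>T ` X. \<Sum>x | x \<in> X \<and> T x = t. (T x * U x) *\<^sub>R l x)"
      by (rule sum.image_gen[OF fin])
    also have "\<dots> = (\<Sum>t\<in>T ` X. t *\<^sub>R v t)"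
      by (auto simp: v_def scaleR_sum_right intro!: sum.cong)
    also have "\<dots> = 0"
      using v by (intro sum.neutral) simp
    finally show "(\<Sum>x\<in>X. (T x * U x) *\<^sub>R l x) = 0" .
  qed
qed

section \<open>The covariance criterion in a finite statistical model\<close>

lemma quadratic_nonneg_linear_coeff_zero:
  fixes a b :: real
  assumes "\<And>s. 0 \<le> a * s + b * s\<^sup>2"
  shows "a = 0"
proof (rule ccontr)
  assume "a \<noteq> 0"
  \<comment> \<open>For small \<open>s\<close> the linear term dominates. Taking \<open>d\<close>
    positive and larger than \<open>b\<close> makes the value at \<open>s = - a / d\<close> negative
    whatever the sign of \<open>b\<close>.\<close>
  define d where "d = \<bar>b\<bar> + 1"
  have d: "d > 0" "b < d" by (auto simp: d_def)
  define s where "s = - a / d"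
  have "a * s + b * s\<^sup>2 = a\<^sup>2 / d\<^sup>2 * (b - d)"
    using d by (simp add: s_def field_simps power2_eq_square)
  also have "\<dots> < 0"
    using \<open>a \<noteq> 0\<close> d by (intro mult_pos_neg) auto
  finally show False
    using assms[of s] by linarith
qed

context
  fixes X :: "'a set" and P :: "'p \<Rightarrow> 'a measure"
  assumes fin: "finite X"
    and prob: "\<And>\<theta>. prob_space (P \<theta>)"
    and space_P: "\<And>\<theta>. space (P \<theta>) = X"
    and sets_P: "\<And>\<theta>. sets (P \<theta>) = Pow X"
begin

lemma integrable_finite: "integrable (P \<theta>) f" for f :: "'a \<Rightarrow> real"
proof -
  interpret prob_space "P \<theta>" by (rule prob)
  have "f \<in> borel_measurable (P \<theta>)"
    by (auto simp: measurable_def space_P sets_P)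
  moreover have "AE x in P \<theta>. norm (f x) \<le> Max ((\<lambda>x. \<bar>f x\<bar>) ` X)"
    using fin by (intro AE_I2) (auto simp: space_P)
  ultimately show ?thesis
    by (intro integrable_const_bound) auto
qed

lemma expectation_eq_sum: "(LINT x|P \<theta>. f x) = (\<Sum>x\<in>X. f x * likelihood P x \<theta>)"
  for f :: "'a \<Rightarrow> real"
proof -
  interpret prob_space "P \<theta>" by (rule prob)
  \<comment> \<open>A measure on all subsets of a finite set is determined by its point
    masses.\<close>
  have "P \<theta> = point_measure X (\<lambda>x. ennreal (prob {x}))"
    using fin
    by (intro measure_eqI_finite[of _ X])
      (auto simp: sets_P sets_point_measure emeasure_point_measure_finite emeasure_eq_measure)
  then have "(LINT x|P \<theta>. f x) = (LINT x|point_measure X (\<lambda>x. ennreal (prob {x})). f x)"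
    by simp
  also have "\<dots> = (\<Sum>x\<in>X. f x * likelihood P x \<theta>)"
    using fin by (simp add: lebesgue_integral_point_measure_finite likelihood_def mult.commute)
  finally show ?thesis .
qed

text \<open>The passage from statistics to linear algebra: the scalar equations for the individual
  \<theta> are the coordinates of one equation in the function space.\<close>

lemma expectation_zero_iff:
  "(\<forall>\<theta>. (LINT x|P \<theta>. U x) = 0) \<longleftrightarrow> (\<Sum>x\<in>X. U x *\<^sub>R likelihood P x) = 0"
  by (simp add: expectation_eq_sum fun_eq_iff sum_fun_apply scaleR_fun_def)

text \<open>The squared means cancel, which leaves a comparison of second moments.\<close>

lemma variance_le_iff:
  fixes T T' :: "'a \<Rightarrow> real"
  assumes "(LINT x|P \<theta>. T' x) = (LINT x|P \<theta>. T x)"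
  shows "prob_space.variance (P \<theta>) T \<le> prob_space.variance (P \<theta>) T' \<longleftrightarrow>
    (LINT x|P \<theta>. (T x)\<^sup>2) \<le> (LINT x|P \<theta>. (T' x)\<^sup>2)"
proof -
  interpret prob_space "P \<theta>" by (rule prob)
  show ?thesis
    unfolding variance_eq[OF integrable_finite integrable_finite] using assms by simp
qed

lemma expectation_square_add:
  fixes T U :: "'a \<Rightarrow> real"
  shows "(LINT x|P \<theta>. (T x + s * U x)\<^sup>2)
    = (LINT x|P \<theta>. (T x)\<^sup>2) + 2 * (LINT x|P \<theta>. T x * U x) * s + (LINT x|P \<theta>. (U x)\<^sup>2) * s\<^sup>2"
proof -
  have "(LINT x|P \<theta>. (T x + s * U x)\<^sup>2)
      = (LINT x|P \<theta>. (T x)\<^sup>2 + (2 * s) * (T x * U x) + s\<^sup>2 * (U x)\<^sup>2)"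
    by (intro Bochner_Integration.integral_cong) (auto simp: power2_eq_square algebra_simps)
  then show ?thesis
    by (simp add: integrable_finite)
qed

text \<open>The competitors of \<open>T\<close> are the sums \<open>T + U\<close> with
  \<open>U\<close> an unbiased estimator of zero, and for such \<open>U\<close> the expectation of
  \<open>T * U\<close> is the covariance of \<open>T\<close> and \<open>U\<close>. Perturbing
  \<open>T\<close> by multiples of \<open>U\<close> shows that it must vanish; if it vanishes,
  adding \<open>U\<close> raises the second moment by that of \<open>U\<close>.\<close>

lemma umvue_iff_uncorrelated:
  "umvue P T \<longleftrightarrow>
    (\<forall>U :: 'a \<Rightarrow> real. (\<forall>\<theta>. (LINT x|P \<theta>. U x) = 0) \<longrightarrow> (\<forall>\<theta>. (LINT x|P \<theta>. T x * U x) = 0))"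
    (is "_ \<longleftrightarrow> ?uncor")
proof
  assume "umvue P T"
  then obtain b where b: "umvue_of P b T"
    by (auto simp: umvue_def)
  show ?uncor
  proof (intro allI impI)
    fix U :: "'a \<Rightarrow> real" and \<theta>
    assume U: "\<forall>\<theta>. (LINT x|P \<theta>. U x) = 0"
    \<comment> \<open>The change in variance from \<open>T\<close> to \<open>T + s * U\<close>,
      nonnegative for \<open>s\<close> of either sign.\<close>
    have "0 \<le> 2 * (LINT x|P \<theta>. T x * U x) * s + (LINT x|P \<theta>. (U x)\<^sup>2) * s\<^sup>2" for s
    proof -
      let ?T' = "\<lambda>x. T x + s * U x"
      have mean: "(LINT x|P \<theta>. ?T' x) = (LINT x|P \<theta>. T x)" for \<theta>
        using U by (simp add: integrable_finite)
      then have "?T' \<in> unbiased_estimators P b"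
        using b by (simp add: umvue_of_def unbiased_estimators_def)
      then have "prob_space.variance (P \<theta>) T \<le> prob_space.variance (P \<theta>) ?T'"
        using b by (simp add: umvue_of_def)
      then have "(LINT x|P \<theta>. (T x)\<^sup>2) \<le> (LINT x|P \<theta>. (?T' x)\<^sup>2)"
        by (rule iffD1[OF variance_le_iff[OF mean]])
      then show ?thesis
        by (simp add: expectation_square_add)
    qed
    then have "2 * (LINT x|P \<theta>. T x * U x) = 0"
      by (rule quadratic_nonneg_linear_coeff_zero)
    then show "(LINT x|P \<theta>. T x * U x) = 0"
      by simp
  qed
next
  assume uncor: ?uncor
  \<comment> \<open>The expectation of \<open>T\<close> is the only function that \<open>T\<close>
    can estimate without bias.\<close>
  have "umvue_of P (\<lambda>\<theta>. LINT x|P \<theta>. T x) T"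
    unfolding umvue_of_def
  proof (intro conjI ballI allI)
    show "T \<in> unbiased_estimators P (\<lambda>\<theta>. LINT x|P \<theta>. T x)"
      by (simp add: unbiased_estimators_def)
  next
    fix T' \<theta> assume "T' \<in> unbiased_estimators P (\<lambda>\<theta>. LINT x|P \<theta>. T x)"
    then have mean: "(LINT x|P \<theta>. T' x) = (LINT x|P \<theta>. T x)" for \<theta>
      by (simp add: unbiased_estimators_def)
    define U where "U x = T' x - T x" for x
    have "(LINT x|P \<theta>. U x) = 0" for \<theta>
      using mean by (simp add: U_def integrable_finite)
    then have "(LINT x|P \<theta>. T x * U x) = 0"
      using uncor by blast
    then have "(LINT x|P \<theta>. (T x)\<^sup>2) \<le> (LINT x|P \<theta>. (T' x)\<^sup>2)"
      using expectation_square_add[of \<theta> T 1 U] by (simp add: U_def)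
    then show "prob_space.variance (P \<theta>) T \<le> prob_space.variance (P \<theta>) T'"
      by (rule iffD2[OF variance_le_iff[OF mean]])
  qed
  then show "umvue P T"
    by (auto simp: umvue_def)
qed

end

theorem theorem1:
  fixes X :: "'a set"
    and P :: "'p \<Rightarrow> 'a measure"
    and T :: "'a \<Rightarrow> real"
    and B :: "real \<Rightarrow> ('p \<Rightarrow> real) set"
  assumes "finite X" and "X \<noteq> {}"
    and "\<And>\<theta>. prob_space (P \<theta>)"
    and "\<And>\<theta>. space (P \<theta>) = X"
    and "\<And>\<theta>. sets (P \<theta>) = Pow X"
    and "\<And>t. t \<in> T ` X \<Longrightarrow> linear_basis {likelihood P x | x. x \<in> X \<and> T x = t} (B t)"
  shows "umvue P T \<longleftrightarrow> independent_family snd (SIGMA t:T ` X. B t)"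
proof -
  note model = assms(1,3,4,5)
  \<comment> \<open>Both \<open>U\<close> and \<open>T * U\<close> are read as coefficients of
    relations among the likelihood functions.\<close>
  have "umvue P T \<longleftrightarrow> (\<forall>U. (\<Sum>x\<in>X. U x *\<^sub>R likelihood P x) = 0 \<longrightarrow>
      (\<Sum>x\<in>X. (T x * U x) *\<^sub>R likelihood P x) = 0)"
    by (simp only: umvue_iff_uncorrelated[OF model] expectation_zero_iff[OF model])
  also have "\<dots> \<longleftrightarrow> independent_family snd (SIGMA t:T ` X. B t)"
    unfolding relations_closed_iff_fiber_spans_direct[OF assms(1)]
    by (rule independent_family_linear_bases_iff[symmetric]) (use assms(1,6) in simp_all)
  finally show ?thesis .
qed

end
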